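(* Let $X$ be a compact Hausdorff space, $A$ a commutative semisimple complex Banach algebra with unit element $\mathbf{1}$, $\mathscr{A}$ an admissible Banach $A$-valued function algebra on $X$, and $\mathfrak{A}=\mathscr{A}\cap C(X)\mathbf{1}$. If $\mathfrak{A}$ is a natural function algebra on $X$, then $\vec{\mathrm{sp}}_A(f)=f(X)$ for all $f\in\mathscr{A}$. In particular, $\vec{\mathrm{sp}}_A(f)$ is compact in $A$.
   Context: For a commutative unital complex Banach algebra $B$, $\mathfrak{M}(B)$ denotes its character space (nonzero complex algebra homomorphisms $B\to\mathbb{C}$). $C(X,A)$ is the algebra of continuous functions $X\to A$ and $\|f\|_X=\sup_{x\in X}\|f(x)\|$. A complex function $h:X\to\mathbb{C}$ is identified with the $A$-valued function $x\mapsto h(x)\mathbf{1}$, and an element $a\in A$ is identified with the constant function $x\mapsto a$. An $A$-valued function algebra on $X$ is a subalgebra $\mathscr{A}$ of $C(X,A)$ that contains all constant functions $X\to A$ and separates the points of $X$. It is a Banach $A$-valued function algebra if it is endowed with a complete algebra norm $|||\cdot|||$ whose restriction to $A$ (the constants) is equivalent to the original norm of $A$ and such that $\|f\|_X\le|||f|||$ for all $f\in\mathscr{A}$. It is admissible if $(\phi\circ f)\mathbf{1}\in\mathscr{A}$ for all $\phi\in\mathfrak{M}(A)$ and $f\in\mathscr{A}$. The subalgebra $\mathfrak{A}=\mathscr{A}\cap C(X)\mathbf{1}$ consists of the complex-valued functions in $\mathscr{A}$, with the norm inherited from $\mathscr{A}$. It is natural if the evaluation homomorphisms $\varepsilon_x:h\mapsto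 h(x)$ ($x\in X$) are the only characters of $\mathfrak{A}$. For a commutative unital Banach algebra $B$, a nonempty set $Y$ and a function $g:Y\to B$, the vector-valued spectrum $\vec{\mathrm{sp}}(g)$ is the set of all functions $\lambda:Y\to\mathbb{C}$ such that, for every finite $F\subset Y$, $\mathbf{1}\notin\sum_{y\in F}B\,(\lambda(y)\mathbf{1}-g(y))$. For $f\in\mathscr{A}$ let $\tilde f:\mathfrak{M}(A)\to\mathfrak{A}$, $\tilde f(\phi)=\phi\circ f$; here $\vec{\mathrm{sp}}(\tilde f)$ is taken with $Y=\mathfrak{M}(A)$ and $B=\mathfrak{A}$. For $a\in A$ let $\hat a:\mathfrak{M}(A)\to\mathbb{C}$, $\hat a(\phi)=\phi(a)$. The $A$-valued spectrum of $f\in\mathscr{A}$ is $\vec{\mathrm{sp}}_A(f)=\{a\in A:\hat a\in\vec{\mathrm{sp}}(\tilde f)\}$. *)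

theory Defs
  imports Complex_Main "HOL-Library.FuncSet" "HOL-Library.Function_Algebras"
begin

text \<open>
  Complex scalar multiplication is a class operation; functions carry it pointwise,
  as they carry the pointwise ring operations of \<^theory>\<open>HOL-Library.Function_Algebras\<close>.
\<close>

class scaleC =
  fixes scaleC :: "complex \<Rightarrow> 'a \<Rightarrow> 'a"  (infixr "*\<^sub>C" 75)

instantiation "fun" :: (type, scaleC) scaleC
begin
definition scaleC_fun_def: "c *\<^sub>C f = (\<lambda>x. c *\<^sub>C f x)"
instance ..
end

text \<open>
  Commutative complex Banach algebras with unit element \<open>1 \<noteq> 0\<close>. The norm is complete and
  submultiplicative; \<open>norm 1 = 1\<close> is not required.
\<close>

class comm_complex_banach_algebra = real_normed_algebra + comm_ring_1 + banach + scaleC +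
  assumes scaleC_add_right: "c *\<^sub>C (a + b) = c *\<^sub>C a + c *\<^sub>C b"
    and scaleC_add_left: "(c + d) *\<^sub>C a = c *\<^sub>C a + d *\<^sub>C a"
    and scaleC_scaleC: "c *\<^sub>C (d *\<^sub>C a) = (c * d) *\<^sub>C a"
    and scaleC_one: "1 *\<^sub>C a = a"
    and scaleR_eq_scaleC: "r *\<^sub>R a = complex_of_real r *\<^sub>C a"
    and scaleC_mult_left: "(c *\<^sub>C a) * b = c *\<^sub>C (a * b)"
    and norm_scaleC: "norm (c *\<^sub>C a) = cmod c * norm a"

instantiation complex :: comm_complex_banach_algebra
begin
definition scaleC_complex_def: "c *\<^sub>C (z::complex) = c * z"
instance
  by standard (simp_all add: scaleC_complex_def algebra_simps norm_mult scaleR_conv_of_real)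
end

definition complex_subalgebra :: "'b::{comm_ring_1, scaleC} set \<Rightarrow> bool" where
  "complex_subalgebra B \<longleftrightarrow> 0 \<in> B \<and>
     (\<forall>a\<in>B. \<forall>b\<in>B. a + b \<in> B) \<and> (\<forall>a\<in>B. \<forall>b\<in>B. a * b \<in> B) \<and> (\<forall>c. \<forall>a\<in>B. c *\<^sub>C a \<in> B)"

text \<open>
  The character space of an algebra with carrier \<open>B\<close>. Characters are extensional, so that
  distinct elements of \<open>characters B\<close> are distinct as functions on \<open>B\<close>.
\<close>

definition characters :: "'b::{comm_ring_1, scaleC} set \<Rightarrow> ('b \<Rightarrow> complex) set" where
  "characters B = {\<chi> \<in> extensional B.
     (\<forall>a\<in>B. \<forall>b\<in>B. \<chi> (a + b) = \<chi> a + \<chi> b) \<and>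
     (\<forall>a\<in>B. \<forall>b\<in>B. \<chi> (a * b) = \<chi> a * \<chi> b) \<and>
     (\<forall>c. \<forall>a\<in>B. \<chi> (c *\<^sub>C a) = c * \<chi> a) \<and>
     (\<exists>a\<in>B. \<chi> a \<noteq> 0)}"

definition ring_ideal :: "'a::comm_ring_1 set \<Rightarrow> bool" where
  "ring_ideal I \<longleftrightarrow> 0 \<in> I \<and> (\<forall>a\<in>I. \<forall>b\<in>I. a + b \<in> I) \<and> (\<forall>r. \<forall>a\<in>I. r * a \<in> I)"

definition maximal_ideal :: "'a::comm_ring_1 set \<Rightarrow> bool" where
  "maximal_ideal M \<longleftrightarrow> ring_ideal M \<and> M \<noteq> UNIV \<and>
     (\<forall>I. ring_ideal I \<and> M \<subseteq> I \<longrightarrow> I = M \<or> I = UNIV)"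

text \<open>Semisimplicity of a commutative Banach algebra: the Jacobson radical is zero.\<close>

definition semisimple :: "'a::comm_ring_1 itself \<Rightarrow> bool" where
  "semisimple _ \<longleftrightarrow> \<Inter>{M :: 'a set. maximal_ideal M} = {0}"

definition function_algebra ::
    "('x::topological_space \<Rightarrow> 'a::comm_complex_banach_algebra) set \<Rightarrow> bool" where
  "function_algebra \<A> \<longleftrightarrow>
     (\<forall>f\<in>\<A>. continuous_on UNIV f) \<and> complex_subalgebra \<A> \<and>
     (\<forall>a. (\<lambda>x. a) \<in> \<A>) \<and>
     (\<forall>x y. x \<noteq> y \<longrightarrow> (\<exists>f\<in>\<A>. f x \<noteq> f y))"

definition algebra_norm_on :: "'b::{comm_ring_1, scaleC} set \<Rightarrow> ('b \<Rightarrow> real) \<Rightarrow> bool" where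
  "algebra_norm_on B N \<longleftrightarrow>
     (\<forall>a\<in>B. 0 \<le> N a) \<and> (\<forall>a\<in>B. N a = 0 \<longleftrightarrow> a = 0) \<and>
     (\<forall>a\<in>B. \<forall>b\<in>B. N (a + b) \<le> N a + N b) \<and>
     (\<forall>c. \<forall>a\<in>B. N (c *\<^sub>C a) = cmod c * N a) \<and>
     (\<forall>a\<in>B. \<forall>b\<in>B. N (a * b) \<le> N a * N b)"

definition complete_norm_on :: "'b::{comm_ring_1, scaleC} set \<Rightarrow> ('b \<Rightarrow> real) \<Rightarrow> bool" where
  "complete_norm_on B N \<longleftrightarrow>
     (\<forall>u. (\<forall>n. u n \<in> B) \<and> (\<forall>e>0. \<exists>M. \<forall>m\<ge>M. \<forall>n\<ge>M. N (u m - u n) < e)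
        \<longrightarrow> (\<exists>b\<in>B. (\<lambda>n. N (u n - b)) \<longlonglongrightarrow> 0))"

definition banach_function_algebra ::
    "('x::topological_space \<Rightarrow> 'a::comm_complex_banach_algebra) set \<Rightarrow>
     (('x \<Rightarrow> 'a) \<Rightarrow> real) \<Rightarrow> bool" where
  "banach_function_algebra \<A> N \<longleftrightarrow>
     function_algebra \<A> \<and> algebra_norm_on \<A> N \<and> complete_norm_on \<A> N \<and>
     (\<exists>c C. 0 < c \<and> 0 < C \<and> (\<forall>a. c * norm a \<le> N (\<lambda>x. a) \<and> N (\<lambda>x. a) \<le> C * norm a)) \<and>
     (\<forall>f\<in>\<A>. (SUP x. norm (f x)) \<le> N f)"

definition admissible ::
    "('x \<Rightarrow> 'a::comm_complex_banach_algebra) set \<Rightarrow> bool" where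
  "admissible \<A> \<longleftrightarrow> (\<forall>\<phi>\<in>characters UNIV. \<forall>f\<in>\<A>. (\<lambda>x. \<phi> (f x) *\<^sub>C 1) \<in> \<A>)"

text \<open>
  The subalgebra \<open>\<A> \<inter> C(X)1\<close>, with \<open>h\<close> and \<open>h1\<close> identified: its elements are
  represented as complex-valued functions \<open>h\<close>.
\<close>

definition scalar_part ::
    "('x::topological_space \<Rightarrow> 'a::comm_complex_banach_algebra) set \<Rightarrow> ('x \<Rightarrow> complex) set" where
  "scalar_part \<A> = {h. continuous_on UNIV h \<and> (\<lambda>x. h x *\<^sub>C 1) \<in> \<A>}"

definition natural :: "('x \<Rightarrow> complex) set \<Rightarrow> bool" where
  "natural B \<longleftrightarrow> characters B = range (\<lambda>x. \<lambda>h\<in>B. h x)"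

text \<open>
  The vector-valued spectrum of \<open>g : Y \<rightarrow> B\<close>; functions on \<open>Y\<close> are extensional.
\<close>

definition vector_spectrum ::
    "'b::{comm_ring_1, scaleC} set \<Rightarrow> 'y set \<Rightarrow> ('y \<Rightarrow> 'b) \<Rightarrow> ('y \<Rightarrow> complex) set" where
  "vector_spectrum B Y g = {l \<in> extensional Y. \<forall>F. finite F \<and> F \<subseteq> Y \<longrightarrow>
     1 \<notin> {(\<Sum>y\<in>F. b y * (l y *\<^sub>C 1 - g y)) | b. \<forall>y\<in>F. b y \<in> B}}"

definition gelfand :: "'a::comm_complex_banach_algebra \<Rightarrow> ('a \<Rightarrow> complex) \<Rightarrow> complex" where
  "gelfand a = (\<lambda>\<phi>\<in>characters UNIV. \<phi> a)"

definition algebra_spectrum ::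
    "('x::topological_space \<Rightarrow> 'a::comm_complex_banach_algebra) set \<Rightarrow> ('x \<Rightarrow> 'a) \<Rightarrow> 'a set" where
  "algebra_spectrum \<A> f =
     {a. gelfand a \<in> vector_spectrum (scalar_part \<A>) (characters UNIV) (\<lambda>\<phi>. \<phi> \<circ> f)}"

end

theory Submission
  imports Defs "HOL-Analysis.Topology_Euclidean_Space"
begin

text \<open>
  Write \<open>\<BB>\<close> for the scalar part of \<open>\<A>\<close>. A function \<open>l\<close> lies in the vector-valued spectrum of
  \<open>g : Y \<rightarrow> \<BB>\<close> exactly when the elements \<open>l y \<cdot> 1 - g y\<close> generate a proper ideal of \<open>\<BB>\<close>. In a
  commutative unital Banach algebra every proper ideal lies in the kernel of a character, and
  the kernel of a character is proper, so the vector-valued spectrum consists of the functions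
  \<open>y \<mapsto> \<psi> (g y)\<close> with \<open>\<psi>\<close> a character of \<open>\<BB>\<close> (\<open>vector_spectrum_eq_characters\<close>). For a natural
  \<open>\<BB>\<close> the \<open>\<psi>\<close> are the evaluations, so \<open>a\<close> belongs to the spectrum of \<open>f\<close> if and only if some
  point \<open>x\<close> satisfies \<open>\<phi> a = \<phi> (f x)\<close> for all characters \<open>\<phi>\<close> of the algebra of values. Semisimplicity
  turns this into \<open>a = f x\<close> (\<open>semisimple_characters_separate\<close>), and the compactness of the
  spectrum is that of a continuous image of a compact space.

  The existence of characters is needed twice: for \<open>\<BB>\<close>, an algebra carried by a set of
  functions, and for the algebra of values, where it identifies the Jacobson radical with the
  common kernel of the characters. It is therefore proved for an algebra with a carrier set and
  a norm function (\<open>proper_ideal_in_kernel_of_character\<close>). Its core is the Gelfand-Mazur theorem.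
  Instead of passing to the quotient by an ideal, the argument works with the distance to the
  ideal, which is a submultiplicative seminorm \<open>p\<close>, and with congruences modulo the null space of
  \<open>p\<close>. The nonemptiness of the spectrum in this setting (\<open>spectrum_nonempty\<close>) follows an
  elementary argument of Rickart, with finite averages over roots of unity in place of Cauchy
  integrals.
\<close>

section \<open>Algebras and seminorms on a carrier set\<close>

text \<open>
  The carrier is a subset of a ring type, so that an algebra of functions and an algebra that
  fills a whole type are both instances.
\<close>

locale unital_complex_algebra =
  fixes B :: "'b::{comm_ring_1, scaleC} set"
  assumes subalgebra: "complex_subalgebra B"
    and one_mem: "1 \<in> B"
    and scale_add: "(c + d) *\<^sub>C (1::'b) = c *\<^sub>C 1 + d *\<^sub>C 1"
    and scale_scale: "c *\<^sub>C d *\<^sub>C (a::'b) = (c * d) *\<^sub>C a"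
    and scale_one: "1 *\<^sub>C (1::'b) = 1"
    and scale_mult: "(c *\<^sub>C (a::'b)) * b = c *\<^sub>C (a * b)"
begin

text \<open>
  The embedding of the scalars turns scalar multiplication into ring multiplication, so that
  the identities below are accessible to the simplification of ring terms.
\<close>

definition emb :: "complex \<Rightarrow> 'b" where
  "emb c = c *\<^sub>C 1"

lemma scale_eq_emb: "c *\<^sub>C a = emb c * a"
  by (simp add: emb_def scale_mult)

lemma emb_add: "emb (c + d) = emb c + emb d"
  by (simp add: emb_def scale_add)

lemma emb_mult: "emb (c * d) = emb c * emb d"
  by (simp add: emb_def scale_mult scale_scale)

lemma emb_1 [simp]: "emb 1 = 1"
  by (simp add: emb_def scale_one)

lemma emb_0 [simp]: "emb 0 = 0"
  using emb_add[of 0 0] by simp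

lemma emb_minus: "emb (- c) = - emb c"
  using emb_add[of c "- c"] by (simp add: eq_neg_iff_add_eq_0 add.commute)

lemma emb_diff: "emb (c - d) = emb c - emb d"
  using emb_add[of c "- d"] by (simp add: emb_minus)

lemma emb_power: "emb (c ^ n) = emb c ^ n"
  by (induction n) (simp_all add: emb_mult)

lemma emb_sum: "emb (sum f S) = (\<Sum>i\<in>S. emb (f i))"
  by (induction S rule: infinite_finite_induct) (simp_all add: emb_add)

lemma emb_inverse: "c \<noteq> 0 \<Longrightarrow> emb c * emb (inverse c) = 1"
  by (simp flip: emb_mult)

lemma zero_mem: "0 \<in> B"
  and add_mem: "a \<in> B \<Longrightarrow> b \<in> B \<Longrightarrow> a + b \<in> B"
  and mult_mem: "a \<in> B \<Longrightarrow> b \<in> B \<Longrightarrow> a * b \<in> B"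
  and scale_mem: "a \<in> B \<Longrightarrow> c *\<^sub>C a \<in> B"
  using subalgebra by (auto simp: complex_subalgebra_def)

lemma emb_mem: "emb c \<in> B"
  unfolding emb_def by (rule scale_mem[OF one_mem])

lemma minus_mem: "a \<in> B \<Longrightarrow> - a \<in> B"
  using scale_mem[of a "-1"] by (simp add: scale_eq_emb emb_minus)

lemma diff_mem: "a \<in> B \<Longrightarrow> b \<in> B \<Longrightarrow> a - b \<in> B"
  using add_mem[OF _ minus_mem, of a b] by simp

lemma power_mem: "a \<in> B \<Longrightarrow> a ^ n \<in> B"
  by (induction n) (auto intro: one_mem mult_mem)

lemma sum_mem: "(\<And>i. i \<in> S \<Longrightarrow> f i \<in> B) \<Longrightarrow> sum f S \<in> B"
  by (induction S rule: infinite_finite_induct) (auto intro: zero_mem add_mem)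

lemmas mem_rules = zero_mem one_mem add_mem mult_mem emb_mem minus_mem diff_mem power_mem sum_mem

definition ideal_on :: "'b set \<Rightarrow> bool" where
  "ideal_on J \<longleftrightarrow> J \<subseteq> B \<and> 0 \<in> J \<and> (\<forall>a\<in>J. \<forall>b\<in>J. a + b \<in> J) \<and> (\<forall>r\<in>B. \<forall>a\<in>J. r * a \<in> J)"

lemma ideal_onD:
  assumes "ideal_on J"
  shows "a \<in> J \<Longrightarrow> a \<in> B" "0 \<in> J" "a \<in> J \<Longrightarrow> b \<in> J \<Longrightarrow> a + b \<in> J"
    "r \<in> B \<Longrightarrow> a \<in> J \<Longrightarrow> r * a \<in> J"
  using assms by (auto simp: ideal_on_def)

lemma ideal_on_diff: "ideal_on J \<Longrightarrow> a \<in> J \<Longrightarrow> b \<in> J \<Longrightarrow> a - b \<in> J"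
  using ideal_onD(3,4)[of J] minus_mem[OF one_mem] by (metis diff_conv_add_uminus mult_minus1)

end

locale algebra_seminorm = unital_complex_algebra +
  fixes p :: "'a \<Rightarrow> real"
  assumes p_nonneg: "a \<in> B \<Longrightarrow> 0 \<le> p a"
    and p_add: "a \<in> B \<Longrightarrow> b \<in> B \<Longrightarrow> p (a + b) \<le> p a + p b"
    and p_scale: "a \<in> B \<Longrightarrow> p (c *\<^sub>C a) = cmod c * p a"
    and p_mult: "a \<in> B \<Longrightarrow> b \<in> B \<Longrightarrow> p (a * b) \<le> p a * p b"
begin

lemma p_emb_mult: "a \<in> B \<Longrightarrow> p (emb c * a) = cmod c * p a"
  by (simp add: p_scale flip: scale_eq_emb)

lemma p_0 [simp]: "p 0 = 0"
  using p_emb_mult[OF zero_mem, of 0] by simp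

lemma p_minus: "a \<in> B \<Longrightarrow> p (- a) = p a"
  using p_emb_mult[of a "-1"] by (simp add: emb_minus)

lemma p_diff: "a \<in> B \<Longrightarrow> b \<in> B \<Longrightarrow> p (a - b) \<le> p a + p b"
  using p_add[OF _ minus_mem, of a b] by (simp add: p_minus)

lemma p_sum: "(\<And>i. i \<in> S \<Longrightarrow> f i \<in> B) \<Longrightarrow> p (sum f S) \<le> (\<Sum>i\<in>S. p (f i))"
proof (induction S rule: infinite_finite_induct)
  case (insert x F)
  then show ?case
    using p_add[of "f x" "sum f F"] sum_mem[of F f] by auto
qed auto

lemma p_power_mult: "a \<in> B \<Longrightarrow> b \<in> B \<Longrightarrow> p (a * b ^ n) \<le> p a * p b ^ n"
proof (induction n)
  case (Suc n)
  have "p (a * b ^ Suc n) = p (b * (a * b ^ n))"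
    by (simp add: ac_simps)
  also have "\<dots> \<le> p b * p (a * b ^ n)"
    using Suc.prems by (intro p_mult mem_rules)
  also have "\<dots> \<le> p b * (p a * p b ^ n)"
    using Suc by (intro mult_left_mono p_nonneg) auto
  finally show ?case by (simp add: ac_simps)
qed simp

lemma p_power: "a \<in> B \<Longrightarrow> n > 0 \<Longrightarrow> p (a ^ n) \<le> p a ^ n"
  using p_power_mult[of a a "n - 1"] by (cases n) auto

text \<open>
  The null space of the seminorm is an ideal. Membership of \<open>a - b\<close> plays the role of equality in
  the quotient algebra.
\<close>

definition null :: "'a set" where
  "null = {a \<in> B. p a = 0}"

lemma null_add: "a \<in> null \<Longrightarrow> b \<in> null \<Longrightarrow> a + b \<in> null"
  using p_add[of a b] p_nonneg[of "a + b"] by (auto simp: null_def intro: mem_rules)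

lemma null_mult: "r \<in> B \<Longrightarrow> a \<in> null \<Longrightarrow> r * a \<in> null"
  using p_mult[of r a] p_nonneg[of "r * a"] by (auto simp: null_def intro: mem_rules)

lemma null_minus: "a \<in> null \<Longrightarrow> - a \<in> null"
  by (auto simp: null_def p_minus intro: mem_rules)

lemma null_diff: "a \<in> null \<Longrightarrow> b \<in> null \<Longrightarrow> a - b \<in> null"
  using null_add[OF _ null_minus, of a b] by simp

lemma null_zero: "0 \<in> null"
  by (simp add: null_def zero_mem)

lemma null_sum: "(\<And>i. i \<in> S \<Longrightarrow> f i \<in> null) \<Longrightarrow> sum f S \<in> null"
  by (induction S rule: infinite_finite_induct) (auto intro: null_zero null_add)

lemma p_le_of_null_diff:
  assumes "a \<in> B" "b \<in> B" "a - b \<in> null"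
  shows "p a \<le> p b"
  using p_add[of "a - b" b] assms by (auto simp: null_def intro: mem_rules)

end

section \<open>The Gelfand-Mazur theorem for a seminorm\<close>

lemma sum_power_roots_of_unity:
  fixes j n :: nat
  assumes "j < n"
  shows "(\<Sum>k<n. cis (2 * pi * real k / real n) ^ j) = (if j = 0 then of_nat n else 0)"
proof (cases "j = 0")
  case False
  define w where "w = cis (2 * pi * real j / real n)"
  have n: "n > 0" using assms by simp
  have "inj_on (\<lambda>k. cis (2 * pi * real k / real n)) {..<n}"
    using bij_betw_roots_unity[OF n] by (simp add: bij_betw_def)
  from inj_onD[OF this, of j 0] have "w \<noteq> 1"
    using assms False by (auto simp: w_def)
  have "w ^ n = 1"
    using bij_betw_roots_unity[OF n] assms by (auto simp: bij_betw_def w_def)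
  have "(\<Sum>k<n. cis (2 * pi * real k / real n) ^ j) = (\<Sum>k<n. w ^ k)"
    by (intro sum.cong refl) (simp add: w_def Complex.DeMoivre algebra_simps)
  also have "\<dots> = 0"
    using \<open>w \<noteq> 1\<close> \<open>w ^ n = 1\<close> by (simp add: geometric_sum)
  finally show ?thesis using False by simp
qed simp

text \<open>
  The situation to be refuted when \<open>1 \<le> p 1\<close>: every \<open>1 - z x\<close> has an inverse \<open>e z\<close> modulo the null
  space. Using \<open>1 - z x\<close> in place of \<open>x - z\<close> includes the point at infinity of the resolvent of \<open>x\<close>, as \<open>z = 0\<close>.
\<close>

locale seminorm_resolvent = algebra_seminorm +
  fixes x :: 'a and e :: "complex \<Rightarrow> 'a"
  assumes x_mem: "x \<in> B"
    and e_mem: "e z \<in> B"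
    and resolvent: "(1 - emb z * x) * e z - 1 \<in> null"
begin

text \<open>
  The resolvent identity \<open>e z - e w = (z - w) x e(z) e(w)\<close>, read modulo the null space.
\<close>

lemma resolvent_diff: "p (e z - e w) \<le> cmod (z - w) * (p x * p (e z) * p (e w))"
proof -
  have "e z - e w - emb (z - w) * (x * e z * e w)
      = e w * ((1 - emb z * x) * e z - 1) - e z * ((1 - emb w * x) * e w - 1)"
    by (simp add: emb_diff algebra_simps)
  also have "\<dots> \<in> null"
    by (intro null_diff null_mult e_mem resolvent)
  finally have "p (e z - e w) \<le> p (emb (z - w) * (x * e z * e w))"
    by (intro p_le_of_null_diff mem_rules x_mem e_mem)
  also have "\<dots> = cmod (z - w) * p (x * e z * e w)"
    by (intro p_emb_mult mem_rules x_mem e_mem)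
  also have "p (x * e z * e w) \<le> p (x * e z) * p (e w)"
    by (intro p_mult mem_rules x_mem e_mem)
  also have "p (x * e z) \<le> p x * p (e z)"
    by (intro p_mult mem_rules x_mem e_mem)
  finally show ?thesis
    by (simp add: mult_left_mono mult_right_mono p_nonneg e_mem)
qed

text \<open>
  By the resolvent identity, near each \<open>w\<close> the seminorm of the resolvent at most doubles; finitely
  many such neighbourhoods cover the disc.
\<close>

lemma resolvent_bounded:
  obtains K where "K > 0" "\<And>z. cmod z \<le> R \<Longrightarrow> p (e z) \<le> K"
proof -
  \<comment> \<open>The radius is chosen so that the factor of \<open>p (e z)\<close> in the resolvent identity is at most 1/2.\<close>
  define d where "d w = 1 / (2 * ((1 + p x) * (1 + p (e w))))" for w
  have pos: "(1 + p x) * (1 + p (e w)) > 0" for w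
    by (intro mult_pos_pos add_pos_nonneg p_nonneg x_mem e_mem) auto
  have d_pos: "d w > 0" for w
    using pos by (simp add: d_def)
  have loc: "p (e z) \<le> 2 * p (e w)" if "dist w z < d w" for w z
  proof -
    have "cmod (z - w) * (p x * p (e w)) \<le> d w * ((1 + p x) * (1 + p (e w)))"
      using that p_nonneg[OF x_mem] p_nonneg[OF e_mem, of w] less_imp_le[OF d_pos[of w]]
      by (intro mult_mono) (auto simp: dist_norm norm_minus_commute)
    also have "\<dots> = 1 / 2"
      using pos[of w] by (simp add: d_def field_simps)
    finally have "cmod (z - w) * (p x * p (e w)) * p (e z) \<le> 1 / 2 * p (e z)"
      by (rule mult_right_mono) (rule p_nonneg[OF e_mem])
    moreover have "p (e z) \<le> p (e z - e w) + p (e w)"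
      using p_add[OF diff_mem[OF e_mem e_mem] e_mem, of z w w] by simp
    ultimately show ?thesis
      using resolvent_diff[of z w] by (simp add: ac_simps)
  qed
  have "cball 0 R \<subseteq> (\<Union>w\<in>UNIV. ball w (d w))"
  proof
    show "w \<in> (\<Union>w\<in>UNIV. ball w (d w))" for w
      using d_pos[of w] by (intro UN_I[of w]) auto
  qed
  then obtain T where T: "finite T" "cball (0::complex) R \<subseteq> (\<Union>w\<in>T. ball w (d w))"
    by (rule compactE_image[OF compact_cball open_ball])
  have nn: "p (e w) \<ge> 0" for w by (rule p_nonneg[OF e_mem])
  show ?thesis
  proof (rule that[of "1 + (\<Sum>w\<in>T. 2 * p (e w))"])
    show "1 + (\<Sum>w\<in>T. 2 * p (e w)) > 0"
      by (intro add_pos_nonneg sum_nonneg) (auto simp: nn)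
    fix z assume "cmod z \<le> R"
    then obtain w where w: "w \<in> T" "dist w z < d w"
      using T(2) by (force simp: dist_norm)
    have "2 * p (e w) \<le> (\<Sum>w\<in>T. 2 * p (e w))"
      by (rule member_le_sum) (auto simp: w T nn)
    with loc[OF w(2)] show "p (e z) \<le> 1 + (\<Sum>w\<in>T. 2 * p (e w))" by simp
  qed
qed

text \<open>
  A Riemann sum for the mean value of the resolvent on the circle of radius \<open>r\<close>.
\<close>

definition circle_mean :: "nat \<Rightarrow> real \<Rightarrow> 'a" where
  "circle_mean n r =
     emb (1 / of_nat n) * (\<Sum>k<n. e (cis (2 * pi * real k / real n) * of_real r))"

lemma circle_mean_mem: "circle_mean n r \<in> B"
  unfolding circle_mean_def by (intro mem_rules e_mem)

text \<open>
  Expanding \<open>e z (1 - z^n x^n)\<close> as \<open>1 + z x + \<dots> + (z x)^(n-1)\<close> and averaging over the points with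
  \<open>z^n = r^n\<close> leaves only the constant term, because the other powers of the roots of unity sum
  to zero. So the average is an inverse of \<open>1 - (r x)^n\<close>.
\<close>

lemma circle_mean_inverse:
  assumes "n > 0"
  shows "circle_mean n r * (1 - (emb (of_real r) * x) ^ n) - 1 \<in> null"
proof -
  define z where "z k = cis (2 * pi * real k / real n) * of_real r" for k
  have zn: "z k ^ n = of_real r ^ n" for k
  proof -
    have "cis (2 * pi * real k / real n) ^ n = cis (2 * pi * real k)"
      using assms by (simp add: Complex.DeMoivre)
    then show ?thesis
      by (simp add: z_def power_mult_distrib )
  qed
  define y where "y = (emb (of_real r) * x) ^ n"
  have one: "e (z k) * (1 - y) - (\<Sum>j<n. (emb (z k) * x) ^ j) \<in> null" for k
  proof -
    have "1 - y = (1 - emb (z k) * x) * (\<Sum>j<n. (emb (z k) * x) ^ j)"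
      unfolding one_diff_power_eq[symmetric]
      by (simp add: y_def power_mult_distrib zn flip: emb_power)
    moreover have "e (z k) * ((1 - emb (z k) * x) * s) - s
        = s * ((1 - emb (z k) * x) * e (z k) - 1)" for s
      by (simp add: algebra_simps)
    ultimately have "e (z k) * (1 - y) - (\<Sum>j<n. (emb (z k) * x) ^ j)
        = (\<Sum>j<n. (emb (z k) * x) ^ j) * ((1 - emb (z k) * x) * e (z k) - 1)"
      by simp
    also have "\<dots> \<in> null"
      by (intro null_mult mem_rules x_mem resolvent)
    finally show ?thesis .
  qed
  have "(\<Sum>k<n. \<Sum>j<n. (emb (z k) * x) ^ j) = (\<Sum>j<n. emb (\<Sum>k<n. z k ^ j) * x ^ j)"
    unfolding power_mult_distrib emb_power[symmetric] emb_sum sum_distrib_right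
    by (rule sum.swap)
  also have "\<dots> = (\<Sum>j<n. if j = 0 then emb (of_nat n) else 0)"
  proof (intro sum.cong refl)
    fix j assume "j \<in> {..<n}"
    moreover have "(\<Sum>k<n. z k ^ j) = (\<Sum>k<n. cis (2 * pi * real k / real n) ^ j) * of_real r ^ j"
      by (simp add: z_def power_mult_distrib sum_distrib_right)
    ultimately show "emb (\<Sum>k<n. z k ^ j) * x ^ j = (if j = 0 then emb (of_nat n) else 0)"
      by (simp add: sum_power_roots_of_unity)
  qed
  also have "\<dots> = emb (of_nat n)"
    using assms by simp
  finally have main: "(\<Sum>k<n. \<Sum>j<n. (emb (z k) * x) ^ j) = emb (of_nat n)" .
  have n1: "emb (1 / of_nat n) * emb (of_nat n) = 1"
    using assms by (simp flip: emb_mult)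
  have "circle_mean n r * (1 - y) - 1
      = emb (1 / of_nat n) * (\<Sum>k<n. e (z k)) * (1 - y) - emb (1 / of_nat n) * emb (of_nat n)"
    by (simp add: circle_mean_def z_def n1)
  also have "\<dots> = emb (1 / of_nat n) * (\<Sum>k<n. e (z k) * (1 - y) - (\<Sum>j<n. (emb (z k) * x) ^ j))"
    unfolding sum_subtractf main by (simp add: algebra_simps sum_distrib_left)
  also have "\<dots> \<in> null"
    by (intro null_mult null_sum one mem_rules)
  finally show ?thesis by (simp add: y_def)
qed

lemma circle_mean_estimate:
  assumes "n > 0" and f: "\<And>z. f z \<in> B"
    and le: "\<And>k. k < n \<Longrightarrow> p (f k) \<le> C"
  shows "p (emb (1 / of_nat n) * (\<Sum>k<n. f k)) \<le> C"
proof -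
  have "p (emb (1 / of_nat n) * (\<Sum>k<n. f k)) = p (\<Sum>k<n. f k) / n"
    by (subst p_emb_mult) (auto intro!: mem_rules f simp: norm_divide)
  also have "p (\<Sum>k<n. f k) \<le> (\<Sum>k<n. p (f k))"
    by (intro p_sum f)
  also have "\<dots> \<le> n * C"
    using sum_mono[of "{..<n}" "\<lambda>k. p (f k)" "\<lambda>_. C"] le by simp
  finally show ?thesis using assms(1) by (simp add: field_simps)
qed

text \<open>
  Since the circle mean inverts \<open>1 - (r x)^n\<close> and stays bounded, it is close to \<open>1\<close> if and only if
  \<open>(r x)^n\<close> is small. The circle means are Lipschitz in \<open>r\<close> on \<open>[0, R]\<close> with a constant that does not depend on \<open>n\<close>. Hence smallness
  of some power at radius \<open>s\<close> carries over to all radii up to \<open>s + \<eta>\<close> with a fixed step \<open>\<eta>\<close>, and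
  finitely many steps lead from \<open>0\<close> to \<open>R\<close>.
\<close>

lemma power_small_everywhere:
  assumes p1: "p 1 \<ge> 1" and "R \<ge> 0"
  shows "\<exists>n>0. p ((emb (of_real R) * x) ^ n) < 1"
proof -
  define y where "y r n = (emb (of_real r) * x) ^ n" for r :: real and n
  have y_mem: "y r n \<in> B" for r n
    unfolding y_def by (intro mem_rules x_mem)
  obtain K where K: "K > 0" "\<And>z. cmod z \<le> R \<Longrightarrow> p (e z) \<le> K"
    using resolvent_bounded[of R] by metis
  define L where "L = p x * K * K"
  have "L \<ge> 0"
    using K(1) by (simp add: L_def p_nonneg x_mem)
  \<comment> \<open>A circle mean within \<open>\<delta>\<close> of \<open>1\<close> forces \<open>p ((r x)^n) \<le> \<delta> p 1 / (1 - \<delta>) < 1\<close>.\<close>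
  define \<delta> where "\<delta> = 1 / (2 * (1 + p 1))"
  have \<delta>: "\<delta> > 0" "\<delta> * (1 + p 1) < 1"
    using p1 by (auto simp: \<delta>_def)
  define \<eta> where "\<eta> = \<delta> / (2 * (L + 1))"
  have \<eta>: "\<eta> > 0" using \<delta> \<open>L \<ge> 0\<close> by (simp add: \<eta>_def)
  have L\<eta>: "L * \<eta> \<le> \<delta> / 2"
    using \<delta>(1) \<open>L \<ge> 0\<close> by (simp add: \<eta>_def field_simps)
  have norm_z: "cmod (cis t * of_real r) \<le> R" if "0 \<le> r" "r \<le> R" for t r
    using that by (simp add: norm_mult)
  have mean_le: "p (circle_mean n r) \<le> K" if "n > 0" "0 \<le> r" "r \<le> R" for n r
    unfolding circle_mean_def using that
    by (intro circle_mean_estimate e_mem K(2) norm_z)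
  have mean_Lipschitz: "p (circle_mean n r - circle_mean n s) \<le> L * \<bar>r - s\<bar>"
    if "n > 0" "0 \<le> r" "r \<le> R" "0 \<le> s" "s \<le> R" for n r s
  proof -
    have "p (e (cis t * of_real r) - e (cis t * of_real s)) \<le> L * \<bar>r - s\<bar>" for t
    proof -
      have "cmod (cis t * of_real r - cis t * of_real s) = cmod (cis t * of_real (r - s))"
        by (simp add: algebra_simps)
      also have "\<dots> = \<bar>r - s\<bar>"
        by (simp only: norm_mult norm_cis norm_of_real mult_1)
      finally have "p (e (cis t * of_real r) - e (cis t * of_real s))
          \<le> \<bar>r - s\<bar> * (p x * p (e (cis t * of_real r)) * p (e (cis t * of_real s)))"
        using resolvent_diff[of "cis t * of_real r" "cis t * of_real s"] by simp
      also have "\<dots> \<le> \<bar>r - s\<bar> * (p x * K * K)"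
        using K that by (intro mult_left_mono mult_mono norm_z mult_nonneg_nonneg p_nonneg x_mem e_mem)
          (auto intro!: K(2) norm_z p_nonneg x_mem e_mem)
      finally show ?thesis by (simp add: L_def mult.commute)
    qed
    moreover have "circle_mean n r - circle_mean n s = emb (1 / of_nat n) * (\<Sum>k<n.
        e (cis (2 * pi * real k / real n) * of_real r) - e (cis (2 * pi * real k / real n) * of_real s))"
      by (simp add: circle_mean_def sum_subtractf algebra_simps)
    ultimately show ?thesis
      using that(1) by (auto intro!: circle_mean_estimate mem_rules e_mem)
  qed
  have step: "\<exists>n>0. p (y r n) < 1"
    if s: "\<exists>n>0. p (y s n) < 1" and "0 \<le> s" "s \<le> r" "r \<le> R" "r - s \<le> \<eta>" for r s
  proof -
    from s obtain n where n: "n > 0" "p (y s n) < 1" by blast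
    define q where "q = p (y s n)"
    have q: "0 \<le> q" "q < 1" using n by (auto simp: q_def p_nonneg y_mem)
    \<comment> \<open>A further power makes the circle mean at \<open>s\<close> as close to \<open>1\<close> as required.\<close>
    obtain m where m: "q ^ m < \<delta> / (2 * K)"
      using real_arch_pow_inv[of "\<delta> / (2 * K)" q] \<delta> K(1) q by auto
    define N where "N = n * Suc m"
    have N: "N > 0" using n by (simp add: N_def)
    have "y s N = y s n ^ Suc m"
      unfolding y_def N_def by (rule power_mult)
    then have "p (y s N) \<le> q ^ Suc m"
      unfolding q_def by (simp only:) (rule p_power[OF y_mem]; simp)
    also have "\<dots> \<le> q ^ m"
      using q by (intro power_decreasing) auto
    finally have yN: "p (y s N) < \<delta> / (2 * K)" using m by simp
    have r: "0 \<le> r" "s \<le> R" using that by auto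
    have "circle_mean N s - 1 - circle_mean N s * y s N \<in> null"
      using circle_mean_inverse[OF N, of s] by (simp add: y_def algebra_simps)
    then have "p (circle_mean N s - 1) \<le> p (circle_mean N s * y s N)"
      by (intro p_le_of_null_diff mem_rules circle_mean_mem y_mem)
    also have "\<dots> \<le> p (circle_mean N s) * p (y s N)"
      by (intro p_mult circle_mean_mem y_mem)
    also have "\<dots> \<le> K * p (y s N)"
      using mean_le[OF N] that r by (intro mult_right_mono p_nonneg y_mem) auto
    also have "\<dots> < \<delta> / 2"
      using yN K(1) by (simp add: field_simps)
    finally have *: "p (circle_mean N s - 1) < \<delta> / 2" .
    have "p (circle_mean N r - circle_mean N s) \<le> L * \<bar>r - s\<bar>"
      using that r by (intro mean_Lipschitz N)
    also have "\<dots> \<le> L * \<eta>"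
      using that \<open>L \<ge> 0\<close> by (intro mult_left_mono) auto
    finally have **: "p (circle_mean N r - circle_mean N s) \<le> \<delta> / 2"
      using L\<eta> by simp
    have "p (circle_mean N r - 1) \<le> p (circle_mean N r - circle_mean N s) + p (circle_mean N s - 1)"
      using p_add[of "circle_mean N r - circle_mean N s" "circle_mean N s - 1"]
      by (simp add: mem_rules circle_mean_mem)
    with * ** have c: "p (circle_mean N r - 1) \<le> \<delta>" by simp
    \<comment> \<open>If \<open>u (1 - y) = 1\<close> then \<open>y = (u - 1) (1 - y)\<close>: closeness of \<open>u\<close> to \<open>1\<close> bounds \<open>y\<close>.\<close>
    have "y r N - (circle_mean N r - 1) * (1 - y r N)
        = - (circle_mean N r * (1 - y r N) - 1)"
      by (simp add: algebra_simps)
    also have "\<dots> \<in> null"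
      unfolding y_def by (intro null_minus circle_mean_inverse N)
    finally have "p (y r N) \<le> p ((circle_mean N r - 1) * (1 - y r N))"
      by (intro p_le_of_null_diff mem_rules circle_mean_mem y_mem)
    also have "\<dots> \<le> p (circle_mean N r - 1) * p (1 - y r N)"
      by (intro p_mult mem_rules circle_mean_mem y_mem)
    also have "\<dots> \<le> \<delta> * (p 1 + p (y r N))"
      using c \<delta>(1) by (intro mult_mono p_diff p_nonneg mem_rules y_mem) auto
    finally have "p (y r N) * (1 - \<delta>) \<le> \<delta> * p 1"
      by (simp add: algebra_simps)
    also have "\<dots> < 1 * (1 - \<delta>)"
      using \<delta>(2) by (simp add: algebra_simps)
    finally have "p (y r N) < 1"
    proof (rule mult_right_less_imp_less)
      show "0 \<le> 1 - \<delta>" using p1 by (simp add: \<delta>_def field_simps)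
    qed
    with N show ?thesis by blast
  qed
  have "\<exists>n>0. p (y (min R (real k * \<eta>)) n) < 1" for k
  proof (induction k)
    case 0
    have "p (y 0 1) < 1" by (simp add: y_def)
    then show ?case using \<open>R \<ge> 0\<close> by (auto intro!: exI[of _ 1])
  next
    case (Suc k)
    show ?case
      by (rule step[OF Suc]) (use \<eta> \<open>R \<ge> 0\<close> in \<open>auto simp: min_def algebra_simps\<close>)
  qed
  moreover obtain k :: nat where "R < real k * \<eta>"
    using reals_Archimedean3[OF \<eta>] by blast
  ultimately have "\<exists>n>0. p (y R n) < 1"
    by (metis less_imp_le min_absorb1)
  then show ?thesis by (simp add: y_def)
qed

end

text \<open>
  If all \<open>x - c\<close> were invertible modulo the null space, then so would be all \<open>1 - z x\<close>, and the powers
  \<open>(r x)^n\<close> would become small for every \<open>r\<close>. With \<open>r = p y\<close>, where \<open>y\<close> is an inverse of \<open>x\<close>, this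
  contradicts \<open>1 \<le> p 1 = p (x^n y^n)\<close>.
\<close>

lemma (in algebra_seminorm) spectrum_nonempty:
  assumes "x \<in> B" "p 1 \<ge> 1"
  shows "\<exists>c. \<forall>y\<in>B. (x - emb c) * y - 1 \<notin> null"
proof (rule ccontr)
  assume "\<not> ?thesis"
  then have "\<forall>c. \<exists>y. y \<in> B \<and> (x - emb c) * y - 1 \<in> null" by blast
  then obtain f where f: "\<And>c. f c \<in> B" "\<And>c. (x - emb c) * f c - 1 \<in> null" by metis
  define e where "e z = (if z = 0 then 1 else emb (- inverse z) * f (inverse z))" for z
  interpret seminorm_resolvent B p x e
  proof
    show "x \<in> B" by fact
    show "e z \<in> B" for z by (auto simp: e_def intro!: mem_rules f)
    show "(1 - emb z * x) * e z - 1 \<in> null" for z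
    proof (cases "z = 0")
      case False
      have "(1 - emb z * x) * e z
          = (emb z * emb (inverse z) * x - emb (inverse z)) * f (inverse z)"
        using False by (simp add: e_def emb_minus algebra_simps)
      then have "(1 - emb z * x) * e z = (x - emb (inverse z)) * f (inverse z)"
        by (simp add: emb_inverse[OF False])
      with f(2) show ?thesis by simp
    qed (simp add: e_def null_zero)
  qed
  obtain n where n: "n > 0" "p ((emb (of_real (p (f 0))) * x) ^ n) < 1"
    using power_small_everywhere[OF assms(2) p_nonneg[OF f(1)[of 0]]] by blast
  have pn: "p ((emb (of_real (p (f 0))) * x) ^ n) = p (f 0) ^ n * p (x ^ n)"
    by (simp add: power_mult_distrib norm_power p_nonneg f p_emb_mult power_mem x_mem flip: emb_power)
  have "(x * f 0) ^ m - 1 \<in> null" for m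
  proof (induction m)
    case (Suc m)
    have "(x * f 0) ^ Suc m - 1 = (x * f 0) * ((x * f 0) ^ m - 1) + ((x - emb 0) * f 0 - 1)"
      by (simp add: algebra_simps)
    also have "\<dots> \<in> null"
      by (intro null_add null_mult Suc f mem_rules x_mem)
    finally show ?case .
  qed (simp add: null_zero)
  from null_minus[OF this[of n]] have "p 1 \<le> p ((x * f 0) ^ n)"
    by (intro p_le_of_null_diff mem_rules x_mem f) simp
  also have "\<dots> \<le> p (x ^ n) * p (f 0) ^ n"
    unfolding power_mult_distrib by (intro p_power_mult mem_rules x_mem f)
  also have "\<dots> < 1" using n pn by (simp add: mult.commute)
  finally show False using assms(2) by simp
qed

section \<open>Characters and ideals\<close>

context unital_complex_algebra
begin

lemma character_rules:
  assumes "\<psi> \<in> characters B"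
  shows "a \<in> B \<Longrightarrow> b \<in> B \<Longrightarrow> \<psi> (a + b) = \<psi> a + \<psi> b"
    and "a \<in> B \<Longrightarrow> b \<in> B \<Longrightarrow> \<psi> (a * b) = \<psi> a * \<psi> b"
    and "a \<in> B \<Longrightarrow> \<psi> (c *\<^sub>C a) = c * \<psi> a"
  using assms by (auto simp: characters_def)

lemma character_1:
  assumes "\<psi> \<in> characters B"
  shows "\<psi> 1 = 1"
proof -
  obtain a where "a \<in> B" "\<psi> a \<noteq> 0"
    using assms by (auto simp: characters_def)
  with character_rules(2)[OF assms _ one_mem, of a] show ?thesis by simp
qed

lemma character_emb:
  assumes "\<psi> \<in> characters B"
  shows "\<psi> (emb c) = c"
  using character_rules(3)[OF assms one_mem, of c] by (simp add: emb_def character_1[OF assms])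

lemma character_diff:
  assumes "\<psi> \<in> characters B" "a \<in> B" "b \<in> B"
  shows "\<psi> (a - b) = \<psi> a - \<psi> b"
  using character_rules(1)[OF assms(1) diff_mem assms(3), of a b] assms by simp

lemma character_0:
  assumes "\<psi> \<in> characters B"
  shows "\<psi> 0 = 0"
  using character_diff[OF assms one_mem one_mem] by simp

lemma character_sum:
  assumes "\<psi> \<in> characters B" "\<And>i. i \<in> S \<Longrightarrow> f i \<in> B"
  shows "\<psi> (sum f S) = (\<Sum>i\<in>S. \<psi> (f i))"
  using assms(2)
proof (induction S rule: infinite_finite_induct)
  case (insert i F)
  then show ?case
    using character_rules(1)[OF assms(1), of "f i" "sum f F"] sum_mem[of F f] by simp
qed (auto simp: character_0[OF assms(1)])

lemma ideal_on_Union_chain: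
  assumes "\<C> \<noteq> {}" "subset.chain {J. ideal_on J} \<C>"
  shows "ideal_on (\<Union>\<C>)"
proof -
  have id: "ideal_on J" if "J \<in> \<C>" for J
    using that assms(2) by (auto simp: subset.chain_def)
  have "a + b \<in> \<Union>\<C>" if a: "J \<in> \<C>" "a \<in> J" and b: "K \<in> \<C>" "b \<in> K" for a b J K
  proof -
    have "J \<subseteq> K \<or> K \<subseteq> J"
      using assms(2) a b by (auto simp: subset_chain_def)
    then show ?thesis
      using a b ideal_onD(3)[OF id] by blast
  qed
  moreover have "0 \<in> \<Union>\<C>"
    using assms(1) ideal_onD(2)[OF id] by blast
  ultimately show ?thesis
    using ideal_onD(1)[OF id] ideal_onD(4)[OF id] unfolding ideal_on_def by blast
qed

lemma maximal_ideal_exists: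
  assumes "ideal_on J" "1 \<notin> J"
  obtains M where "ideal_on M" "1 \<notin> M" "J \<subseteq> M"
    "\<And>K. ideal_on K \<Longrightarrow> 1 \<notin> K \<Longrightarrow> M \<subseteq> K \<Longrightarrow> K = M"
proof -
  let ?P = "{K. ideal_on K \<and> 1 \<notin> K \<and> J \<subseteq> K}"
  have "\<exists>M\<in>?P. \<forall>K\<in>?P. M \<subseteq> K \<longrightarrow> K = M"
  proof (rule subset_Zorn_nonempty)
    show "?P \<noteq> {}" using assms by blast
    fix \<C> assume C: "\<C> \<noteq> {}" "subset.chain ?P \<C>"
    then have "subset.chain {J. ideal_on J} \<C>"
      by (auto simp: subset_chain_def)
    then have "ideal_on (\<Union>\<C>)"
      by (rule ideal_on_Union_chain[OF C(1)])
    moreover have "1 \<notin> \<Union>\<C>" "J \<subseteq> \<Union>\<C>"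
      using C unfolding subset_chain_def by blast+
    ultimately show "\<Union>\<C> \<in> ?P" by blast
  qed
  then obtain M where M: "M \<in> ?P" and max: "\<forall>K\<in>?P. M \<subseteq> K \<longrightarrow> K = M"
    by (rule bexE)
  show ?thesis
  proof (rule that[of M])
    show "K = M" if "ideal_on K" "1 \<notin> K" "M \<subseteq> K" for K
      using max M that by blast
  qed (use M in auto)
qed

lemma ideal_on_add_principal:
  assumes "ideal_on J" "a \<in> B"
  shows "ideal_on {i + a * b | i b. i \<in> J \<and> b \<in> B}" (is "ideal_on ?K")
  unfolding ideal_on_def
proof (intro conjI ballI)
  show "?K \<subseteq> B"
    using ideal_onD(1)[OF assms(1)] assms(2) by (auto intro!: mem_rules)
  have "0 + a * 0 \<in> ?K"
    using ideal_onD(2)[OF assms(1)] zero_mem by blast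
  then show "0 \<in> ?K" by simp
next
  fix u v assume "u \<in> ?K" "v \<in> ?K"
  then obtain i j b c where *: "u = i + a * b" "v = j + a * c" "i \<in> J" "j \<in> J" "b \<in> B" "c \<in> B"
    by blast
  then have "u + v = (i + j) + a * (b + c)" by (simp add: algebra_simps)
  moreover have "i + j \<in> J" "b + c \<in> B"
    using * ideal_onD(3)[OF assms(1)] add_mem by auto
  ultimately show "u + v \<in> ?K" by blast
next
  fix r u assume "r \<in> B" "u \<in> ?K"
  then obtain i b where *: "u = i + a * b" "i \<in> J" "b \<in> B" by blast
  then have "r * u = r * i + a * (r * b)" by (simp add: algebra_simps)
  moreover have "r * i \<in> J" "r * b \<in> B"
    using * \<open>r \<in> B\<close> ideal_onD(4)[OF assms(1)] mult_mem by auto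
  ultimately show "r * u \<in> ?K" by blast
qed

text \<open>
  When every element is congruent to a scalar modulo \<open>M\<close>, sending it to that scalar is the
  quotient map onto the complex numbers.
\<close>

lemma character_of_scalar_quotient:
  assumes M: "ideal_on M" "1 \<notin> M"
    and scalar: "\<And>a. a \<in> B \<Longrightarrow> \<exists>c. a - emb c \<in> M"
  shows "\<exists>\<psi>\<in>characters B. \<forall>a\<in>M. \<psi> a = 0"
proof -
  have unique: "c = d" if c: "a - emb c \<in> M" and d: "a - emb d \<in> M" for a c d
  proof (rule ccontr)
    assume "c \<noteq> d"
    have "(a - emb d) - (a - emb c) \<in> M"
      by (rule ideal_on_diff[OF M(1) d c])
    then have "emb (inverse (c - d)) * emb (c - d) \<in> M"
      by (intro ideal_onD(4)[OF M(1)] emb_mem) (simp add: emb_diff)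
    with \<open>c \<noteq> d\<close> M(2) show False by (simp flip: emb_mult)
  qed
  define \<psi> where "\<psi> = (\<lambda>a\<in>B. THE c. a - emb c \<in> M)"
  have \<psi>: "\<psi> a = c" if "a \<in> B" "a - emb c \<in> M" for a c
    using that unique by (auto simp: \<psi>_def intro!: the_equality)
  have \<psi>_mem: "a - emb (\<psi> a) \<in> M" if "a \<in> B" for a
    using scalar[OF that] \<psi>[OF that] by auto
  have "\<psi> (a + b) = \<psi> a + \<psi> b" if "a \<in> B" "b \<in> B" for a b
  proof (rule \<psi>)
    have "a + b - emb (\<psi> a + \<psi> b) = (a - emb (\<psi> a)) + (b - emb (\<psi> b))"
      by (simp add: emb_add)
    also have "\<dots> \<in> M"
      using ideal_onD(3)[OF M(1)] \<psi>_mem that by simp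
    finally show "a + b - emb (\<psi> a + \<psi> b) \<in> M" .
  qed (intro mem_rules that)
  moreover have "\<psi> (a * b) = \<psi> a * \<psi> b" if "a \<in> B" "b \<in> B" for a b
  proof (rule \<psi>)
    have "a * b - emb (\<psi> a * \<psi> b) = b * (a - emb (\<psi> a)) + emb (\<psi> a) * (b - emb (\<psi> b))"
      by (simp add: emb_mult algebra_simps)
    then show "a * b - emb (\<psi> a * \<psi> b) \<in> M"
      using ideal_onD(3,4)[OF M(1)] \<psi>_mem that emb_mem by simp
  qed (intro mem_rules that)
  moreover have "\<psi> (c *\<^sub>C a) = c * \<psi> a" if "a \<in> B" for a c
  proof (rule \<psi>)
    have "c *\<^sub>C a - emb (c * \<psi> a) = emb c * (a - emb (\<psi> a))"
      by (simp add: scale_eq_emb emb_mult algebra_simps)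
    then show "c *\<^sub>C a - emb (c * \<psi> a) \<in> M"
      using ideal_onD(4)[OF M(1)] \<psi>_mem that emb_mem by simp
  qed (intro scale_mem that)
  moreover have "\<psi> 1 = 1"
    by (rule \<psi>) (auto intro: one_mem ideal_onD(2)[OF M(1)])
  moreover have "\<psi> a = 0" if "a \<in> M" for a
    by (rule \<psi>) (use that ideal_onD(1)[OF M(1)] in auto)
  ultimately show ?thesis
    using one_mem by (intro bexI[of _ \<psi>]) (auto simp: characters_def \<psi>_def intro!: bexI[of _ 1])
qed

text \<open>
  The ideal generated by a family, in the form in which it enters the vector-valued spectrum.
\<close>

lemma ideal_on_finite_combinations:
  assumes h: "\<And>y. y \<in> Y \<Longrightarrow> h y \<in> B"
  shows "ideal_on {\<Sum>y\<in>F. b y * h y | F b. finite F \<and> F \<subseteq> Y \<and> (\<forall>y\<in>F. b y \<in> B)}"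
    (is "ideal_on ?J")
  unfolding ideal_on_def
proof (intro conjI ballI)
  show "?J \<subseteq> B"
    using h by (auto intro!: mem_rules)
  show "0 \<in> ?J" by (intro CollectI exI[of _ "{}"]) simp
next
  fix u v assume "u \<in> ?J" "v \<in> ?J"
  then obtain F G b c where F: "u = (\<Sum>y\<in>F. b y * h y)" "finite F" "F \<subseteq> Y" "\<forall>y\<in>F. b y \<in> B"
    and G: "v = (\<Sum>y\<in>G. c y * h y)" "finite G" "G \<subseteq> Y" "\<forall>y\<in>G. c y \<in> B"
    by blast
  \<comment> \<open>Extending the coefficients by zero writes both sums over the same index set.\<close>
  define b' where "b' y = (if y \<in> F then b y else 0)" for y
  define c' where "c' y = (if y \<in> G then c y else 0)" for y
  have "u = (\<Sum>y\<in>F \<union> G. b' y * h y)" "v = (\<Sum>y\<in>F \<union> G. c' y * h y)"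
    unfolding F(1) G(1) using F(2) G(2)
    by (intro sum.mono_neutral_cong_left; simp add: b'_def c'_def)+
  then have "u + v = (\<Sum>y\<in>F \<union> G. (b' y + c' y) * h y)"
    by (simp add: sum.distrib algebra_simps)
  moreover have "\<forall>y\<in>F \<union> G. b' y + c' y \<in> B"
    using F G by (auto simp: b'_def c'_def intro!: mem_rules)
  ultimately show "u + v \<in> ?J"
    using F(2,3) G(2,3)
    by (intro CollectI exI[of _ "F \<union> G"] exI[of _ "\<lambda>y. b' y + c' y"]) auto
next
  fix r u assume "r \<in> B" "u \<in> ?J"
  then obtain F b where F: "u = (\<Sum>y\<in>F. b y * h y)" "finite F" "F \<subseteq> Y" "\<forall>y\<in>F. b y \<in> B"
    by blast
  then have "r * u = (\<Sum>y\<in>F. (r * b y) * h y)"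
    by (simp add: sum_distrib_left mult.assoc)
  with F \<open>r \<in> B\<close> show "r * u \<in> ?J"
    by (intro CollectI exI[of _ F] exI[of _ "\<lambda>y. r * b y"]) (auto intro: mult_mem)
qed

end

section \<open>Existence of characters on Banach algebras\<close>

locale banach_algebra_carrier = algebra_seminorm B N
  for B :: "'b::{comm_ring_1, scaleC} set" and N +
  assumes definite: "a \<in> B \<Longrightarrow> N a = 0 \<Longrightarrow> a = 0"
    and complete: "complete_norm_on B N"
begin

text \<open>
  The Neumann series, with partial sums compared to those of a real geometric series. The
  factor \<open>N 1\<close> appears because \<open>N 1\<close> may exceed \<open>1\<close>.
\<close>

lemma invertible_near_1:
  assumes y: "y \<in> B" "N (1 - y) < 1"
  shows "\<exists>z\<in>B. y * z = 1"
proof -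
  define x where "x = 1 - y"
  have x: "x \<in> B" using y one_mem diff_mem by (simp add: x_def)
  define \<theta> where "\<theta> = N x"
  have \<theta>: "0 \<le> \<theta>" "\<theta> < 1"
    using p_nonneg[OF x] y(2) by (simp_all add: \<theta>_def x_def)
  have pow: "N (x ^ n) \<le> N 1 * \<theta> ^ n" for n
    using p_power_mult[OF one_mem x, of n] by (simp add: \<theta>_def)
  define s where "s n = (\<Sum>k<n. x ^ k)" for n
  have s: "s n \<in> B" for n
    unfolding s_def by (intro mem_rules x)
  define t where "t n = (\<Sum>k<n. N 1 * \<theta> ^ k)" for n
  have "summable (\<lambda>k. N 1 * \<theta> ^ k)"
    using \<theta> by (intro summable_mult summable_geometric) simp
  then have "Cauchy t"
    unfolding t_def summable_iff_convergent by (rule convergent_Cauchy)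
  have le: "N (s m - s n) \<le> \<bar>t m - t n\<bar>" if "n \<le> m" for m n
  proof -
    have "s m - s n = (\<Sum>k\<in>{n..<m}. x ^ k)" "t m - t n = (\<Sum>k\<in>{n..<m}. N 1 * \<theta> ^ k)"
      using sum_diff_nat_ivl[of 0 n m "\<lambda>k. x ^ k"] sum_diff_nat_ivl[of 0 n m "\<lambda>k. N 1 * \<theta> ^ k"] that
      by (simp_all add: s_def t_def atLeast0LessThan)
    moreover have "N (\<Sum>k\<in>{n..<m}. x ^ k) \<le> (\<Sum>k\<in>{n..<m}. N (x ^ k))"
      by (intro p_sum mem_rules x)
    moreover have "\<dots> \<le> (\<Sum>k\<in>{n..<m}. N 1 * \<theta> ^ k)"
      by (intro sum_mono pow)
    ultimately show ?thesis by simp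
  qed
  have le': "N (s m - s n) \<le> \<bar>t m - t n\<bar>" for m n
  proof (cases "n \<le> m")
    case False
    have "N (s m - s n) = N (- (s n - s m))" by simp
    also have "\<dots> = N (s n - s m)" by (intro p_minus mem_rules s)
    finally show ?thesis using le[of m n] False by simp
  qed (rule le)
  have "\<exists>M. \<forall>m\<ge>M. \<forall>n\<ge>M. N (s m - s n) < e" if "e > 0" for e
    using CauchyD[OF \<open>Cauchy t\<close> that] le' by (metis le_less_trans real_norm_def)
  then obtain z where z: "z \<in> B" "(\<lambda>n. N (s n - z)) \<longlonglongrightarrow> 0"
    using complete s unfolding complete_norm_on_def by blast
  have "N (y * z - 1) \<le> N y * N (s n - z) + N 1 * \<theta> ^ n" for n
  proof -
    have "y * z - 1 = - (y * (s n - z)) - x ^ n"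
      using one_diff_power_eq[of x n] by (simp add: s_def x_def algebra_simps)
    then have "N (y * z - 1) \<le> N (- (y * (s n - z))) + N (x ^ n)"
      by (simp only:) (intro p_diff mem_rules x y s z)
    also have "N (- (y * (s n - z))) = N (y * (s n - z))"
      by (intro p_minus mem_rules y s z)
    also have "\<dots> \<le> N y * N (s n - z)"
      by (intro p_mult mem_rules y s z)
    finally show ?thesis using pow[of n] by simp
  qed
  moreover have "(\<lambda>n. N y * N (s n - z) + N 1 * \<theta> ^ n) \<longlonglongrightarrow> N y * 0 + N 1 * 0"
    using \<theta> by (intro tendsto_intros z LIMSEQ_power_zero) simp
  ultimately have "N (y * z - 1) \<le> 0"
    by (intro LIMSEQ_le_const) auto
  then have "N (y * z - 1) = 0"
    using p_nonneg[of "y * z - 1"] y z by (simp add: mem_rules)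
  then have "y * z - 1 = 0"
    by (intro definite mem_rules y z)
  with z(1) show ?thesis by auto
qed

text \<open>
  Otherwise \<open>1 - a / \<psi> a\<close> would be invertible by the Neumann series, although \<open>\<psi>\<close> maps it to zero.
\<close>

lemma character_bounded:
  assumes "\<psi> \<in> characters B" "a \<in> B"
  shows "cmod (\<psi> a) \<le> N a"
proof (rule ccontr)
  assume "\<not> ?thesis"
  then have gt: "N a < cmod (\<psi> a)" by simp
  with p_nonneg[OF assms(2)] have nz: "\<psi> a \<noteq> 0" by auto
  define y where "y = 1 - emb (inverse (\<psi> a)) * a"
  have y: "y \<in> B" unfolding y_def by (intro mem_rules assms)
  have "N (1 - y) = N a / cmod (\<psi> a)"
    unfolding y_def using p_emb_mult[OF assms(2), of "inverse (\<psi> a)"]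
    by (simp add: norm_inverse divide_inverse mult.commute)
  also have "\<dots> < 1" using gt nz by simp
  finally obtain z where z: "z \<in> B" "y * z = 1"
    using invertible_near_1[OF y] by blast
  have "\<psi> y = 0"
    using nz assms unfolding y_def
    by (simp add: character_diff character_1 character_emb character_rules mem_rules)
  then have "\<psi> (y * z) = 0"
    using character_rules(2)[OF assms(1) y z(1)] by simp
  with z character_1[OF assms(1)] show False by simp
qed

text \<open>
  The distance to an ideal, that is, the quotient seminorm pulled back to the algebra.
\<close>

definition ideal_dist :: "'b set \<Rightarrow> 'b \<Rightarrow> real" where
  "ideal_dist J a = (INF i\<in>J. N (a - i))"

lemma ideal_dist_le: "ideal_on J \<Longrightarrow> i \<in> J \<Longrightarrow> a \<in> B \<Longrightarrow> ideal_dist J a \<le> N (a - i)"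
  unfolding ideal_dist_def
  by (intro cINF_lower bdd_belowI2[where m = 0] p_nonneg diff_mem) (auto dest: ideal_onD(1))

text \<open>
  The universal property of the infimum, stated with a factor so that it can be applied once
  for each argument when the distance of a sum or of a product is estimated.
\<close>

lemma le_mult_ideal_dist:
  assumes "ideal_on J" "c \<ge> 0" and le: "\<And>i. i \<in> J \<Longrightarrow> t \<le> c * N (a - i)"
  shows "t \<le> c * ideal_dist J a"
proof (cases "c = 0")
  case True
  then show ?thesis using le[OF ideal_onD(2)[OF assms(1)]] by simp
next
  case False
  with assms have "t / c \<le> ideal_dist J a"
    unfolding ideal_dist_def using ideal_onD(2)[OF assms(1)]
    by (intro cINF_greatest) (auto simp: field_simps)
  with False assms(2) show ?thesis by (simp add: field_simps)
qed

lemma ideal_dist_seminorm: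
  assumes J: "ideal_on J"
  shows "algebra_seminorm B (ideal_dist J)"
proof
  note memJ = ideal_onD(1)[OF J]
  fix a assume a: "a \<in> B"
  show nonneg: "0 \<le> ideal_dist J a"
    using le_mult_ideal_dist[OF J, of 1 0 a] a memJ p_nonneg diff_mem by simp
  show "ideal_dist J (a + b) \<le> ideal_dist J a + ideal_dist J b" if b: "b \<in> B" for b
  proof -
    have "ideal_dist J (a + b) \<le> N (a - i) + N (b - j)" if "i \<in> J" "j \<in> J" for i j
    proof -
      have "ideal_dist J (a + b) \<le> N (a + b - (i + j))"
        by (intro ideal_dist_le J ideal_onD(3)[OF J] that mem_rules a b)
      also have "a + b - (i + j) = (a - i) + (b - j)" by simp
      also have "N \<dots> \<le> N (a - i) + N (b - j)"
        by (intro p_add diff_mem a b memJ that)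
      finally show ?thesis .
    qed
    then have "ideal_dist J (a + b) - N (b - j) \<le> 1 * ideal_dist J a" if "j \<in> J" for j
      using that by (intro le_mult_ideal_dist J) (auto simp: algebra_simps)
    then have "ideal_dist J (a + b) - ideal_dist J a \<le> 1 * ideal_dist J b"
      by (intro le_mult_ideal_dist J) (auto simp: algebra_simps)
    then show ?thesis by simp
  qed
  have scale_le: "ideal_dist J (c *\<^sub>C b) \<le> cmod c * ideal_dist J b" if b: "b \<in> B" for b c
  proof (intro le_mult_ideal_dist J)
    fix i assume i: "i \<in> J"
    have "ideal_dist J (c *\<^sub>C b) \<le> N (c *\<^sub>C b - emb c * i)"
      by (intro ideal_dist_le J ideal_onD(4)[OF J] emb_mem i scale_mem b)
    also have "c *\<^sub>C b - emb c * i = emb c * (b - i)"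
      by (simp add: scale_eq_emb algebra_simps)
    also have "N \<dots> = cmod c * N (b - i)"
      by (intro p_emb_mult diff_mem b memJ i)
    finally show "ideal_dist J (c *\<^sub>C b) \<le> cmod c * N (b - i)" .
  qed simp
  show "ideal_dist J (c *\<^sub>C a) = cmod c * ideal_dist J a" for c
  proof (cases "c = 0")
    case True
    have "0 \<le> ideal_dist J (c *\<^sub>C a)"
      using le_mult_ideal_dist[OF J, of 1 0 "c *\<^sub>C a"] a memJ p_nonneg diff_mem scale_mem by simp
    then show ?thesis using scale_le[OF a, of c] True by simp
  next
    case False
    have "inverse c *\<^sub>C c *\<^sub>C a = a"
      using False by (simp add: scale_eq_emb flip: mult.assoc emb_mult)
    then have "ideal_dist J a \<le> cmod (inverse c) * ideal_dist J (c *\<^sub>C a)"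
      using scale_le[OF scale_mem[OF a], of "inverse c" c] by simp
    then have "cmod c * ideal_dist J a \<le> ideal_dist J (c *\<^sub>C a)"
      unfolding norm_inverse using False by (simp add: field_simps)
    with scale_le[OF a, of c] show ?thesis by simp
  qed
  show "ideal_dist J (a * b) \<le> ideal_dist J a * ideal_dist J b" if b: "b \<in> B" for b
  proof -
    have le: "ideal_dist J (a * b) \<le> N (a - i) * N (b - j)" if "i \<in> J" "j \<in> J" for i j
    proof -
      have "b * i + (a - i) * j \<in> J"
        using that by (intro ideal_onD(3,4)[OF J] diff_mem a b memJ)
      then have "ideal_dist J (a * b) \<le> N (a * b - (b * i + (a - i) * j))"
        by (intro ideal_dist_le J mult_mem a b)
      also have "a * b - (b * i + (a - i) * j) = (a - i) * (b - j)"
        by (simp add: algebra_simps)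
      also have "N \<dots> \<le> N (a - i) * N (b - j)"
        by (intro p_mult diff_mem a b memJ that)
      finally show ?thesis .
    qed
    have "ideal_dist J (a * b) \<le> ideal_dist J b * ideal_dist J a"
    proof (rule le_mult_ideal_dist[OF J])
      show "0 \<le> ideal_dist J b"
        using le_mult_ideal_dist[OF J, of 1 0 b] b memJ p_nonneg diff_mem by simp
      fix i assume i: "i \<in> J"
      have "ideal_dist J (a * b) \<le> N (a - i) * ideal_dist J b"
        by (intro le_mult_ideal_dist J p_nonneg diff_mem a memJ i le)
      then show "ideal_dist J (a * b) \<le> ideal_dist J b * N (a - i)"
        by (simp add: mult.commute)
    qed
    then show ?thesis by (simp add: mult.commute)
  qed
qed

text \<open>
  All elements of the open unit ball around \<open>1\<close> are invertible, and a proper ideal contains no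
  invertible element.
\<close>

lemma ideal_dist_1:
  assumes J: "ideal_on J" "1 \<notin> J"
  shows "ideal_dist J 1 \<ge> 1"
proof -
  have "1 \<le> N (1 - i)" if i: "i \<in> J" for i
  proof (rule ccontr)
    assume "\<not> ?thesis"
    then obtain z where "z \<in> B" "i * z = 1"
      using invertible_near_1[OF ideal_onD(1)[OF J(1) i]] by auto
    then show False
      using ideal_onD(4)[OF J(1), of z i] i J(2) by (simp add: mult.commute)
  qed
  then show ?thesis
    using le_mult_ideal_dist[OF J(1), of 1 1 1] by simp
qed

text \<open>
  The spectrum of \<open>a\<close> modulo \<open>M\<close> contains some \<open>c\<close>, so \<open>a - c\<close> and \<open>M\<close> together generate a proper
  ideal. By maximality it equals \<open>M\<close>.
\<close>

lemma maximal_ideal_scalar_quotient: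
  assumes M: "ideal_on M" "1 \<notin> M"
    and max: "\<And>K. ideal_on K \<Longrightarrow> 1 \<notin> K \<Longrightarrow> M \<subseteq> K \<Longrightarrow> K = M"
    and a: "a \<in> B"
  shows "\<exists>c. a - emb c \<in> M"
proof -
  interpret Q: algebra_seminorm B "ideal_dist M"
    by (rule ideal_dist_seminorm[OF M(1)])
  obtain c where c: "\<And>y. y \<in> B \<Longrightarrow> (a - emb c) * y - 1 \<notin> Q.null"
    using Q.spectrum_nonempty[OF a ideal_dist_1[OF M]] by blast
  define K where "K = {i + (a - emb c) * b | i b. i \<in> M \<and> b \<in> B}"
  have "1 \<notin> K"
  proof
    assume "1 \<in> K"
    then obtain i b where ib: "1 = i + (a - emb c) * b" "i \<in> M" "b \<in> B"
      by (auto simp: K_def)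
    have "i \<in> Q.null"
      using ideal_dist_le[OF M(1) ib(2), of i] Q.p_nonneg[of i] ideal_onD(1)[OF M(1) ib(2)]
      by (simp add: Q.null_def)
    moreover have "(a - emb c) * b - 1 = - i" using ib(1) by (simp add: algebra_simps)
    ultimately show False
      using c[OF ib(3)] Q.null_minus by simp
  qed
  moreover have "ideal_on K"
    unfolding K_def by (intro ideal_on_add_principal M diff_mem emb_mem a)
  moreover have "M \<subseteq> K"
  proof
    fix i assume "i \<in> M"
    then have "i + (a - emb c) * 0 \<in> K" using zero_mem unfolding K_def by blast
    then show "i \<in> K" by simp
  qed
  ultimately have "K = M" by (intro max)
  moreover have "0 + (a - emb c) * 1 \<in> K"
    using ideal_onD(2)[OF M(1)] one_mem unfolding K_def by blast
  ultimately show ?thesis by auto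
qed

theorem proper_ideal_in_kernel_of_character:
  assumes "ideal_on J" "1 \<notin> J"
  shows "\<exists>\<psi>\<in>characters B. \<forall>a\<in>J. \<psi> a = 0"
proof -
  obtain M where M: "ideal_on M" "1 \<notin> M" "J \<subseteq> M"
    and max: "\<And>K. ideal_on K \<Longrightarrow> 1 \<notin> K \<Longrightarrow> M \<subseteq> K \<Longrightarrow> K = M"
    using maximal_ideal_exists[OF assms] by metis
  then obtain \<psi> where "\<psi> \<in> characters B" "\<forall>a\<in>M. \<psi> a = 0"
    using character_of_scalar_quotient[OF M(1,2) maximal_ideal_scalar_quotient[OF M(1,2) max]]
    by blast
  with M(3) show ?thesis by blast
qed

text \<open>
  The defining condition on finite subsets says that the ideal generated by all \<open>l y - g y\<close> is
  proper. A character whose kernel contains this ideal maps \<open>g y\<close> to \<open>l y\<close>.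
\<close>

theorem vector_spectrum_eq_characters:
  assumes g: "\<And>y. y \<in> Y \<Longrightarrow> g y \<in> B"
  shows "vector_spectrum B Y g = (\<lambda>\<psi>. \<lambda>y\<in>Y. \<psi> (g y)) ` characters B"
proof (intro equalityI subsetI)
  fix l assume "l \<in> vector_spectrum B Y g"
  then have l: "l \<in> extensional Y" and "\<forall>F. finite F \<and> F \<subseteq> Y \<longrightarrow>
      1 \<notin> {(\<Sum>y\<in>F. b y * (emb (l y) - g y)) | b. \<forall>y\<in>F. b y \<in> B}"
    unfolding vector_spectrum_def mem_Collect_eq emb_def by (rule conjunct1, rule conjunct2)
  then have no1: "1 \<noteq> (\<Sum>y\<in>F. b y * (emb (l y) - g y))"
    if "finite F" "F \<subseteq> Y" "\<forall>y\<in>F. b y \<in> B" for F b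
    using that by blast
  define J where "J = {\<Sum>y\<in>F. b y * (emb (l y) - g y) | F b. finite F \<and> F \<subseteq> Y \<and> (\<forall>y\<in>F. b y \<in> B)}"
  have "ideal_on J"
    unfolding J_def by (rule ideal_on_finite_combinations) (intro diff_mem emb_mem g)
  moreover have "1 \<notin> J"
    unfolding J_def using no1 by blast
  ultimately obtain \<psi> where \<psi>: "\<psi> \<in> characters B" "\<And>a. a \<in> J \<Longrightarrow> \<psi> a = 0"
    using proper_ideal_in_kernel_of_character by blast
  have "l y = \<psi> (g y)" if y: "y \<in> Y" for y
  proof -
    have "(\<Sum>u\<in>{y}. 1 * (emb (l u) - g u)) \<in> J"
      unfolding J_def using y one_mem by (intro CollectI exI[of _ "{y}"] exI[of _ "\<lambda>_. 1"]) auto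
    then have "\<psi> (emb (l y) - g y) = 0" using \<psi>(2) by simp
    then show ?thesis
      using \<psi>(1) g[OF y] by (simp add: character_diff character_emb emb_mem)
  qed
  then have "l = (\<lambda>y\<in>Y. \<psi> (g y))"
    using l by (auto simp: extensional_def)
  with \<psi>(1) show "l \<in> (\<lambda>\<psi>. \<lambda>y\<in>Y. \<psi> (g y)) ` characters B" by blast
next
  fix l assume "l \<in> (\<lambda>\<psi>. \<lambda>y\<in>Y. \<psi> (g y)) ` characters B"
  then obtain \<psi> where \<psi>: "\<psi> \<in> characters B" and l: "l = (\<lambda>y\<in>Y. \<psi> (g y))" by blast
  have "1 \<noteq> (\<Sum>y\<in>F. b y * (emb (l y) - g y))"
    if F: "finite F" "F \<subseteq> Y" and b: "\<forall>y\<in>F. b y \<in> B" for F b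
  proof
    assume eq: "1 = (\<Sum>y\<in>F. b y * (emb (l y) - g y))"
    have g': "g y \<in> B" if "y \<in> F" for y using F g that by auto
    have "\<psi> (b y * (emb (l y) - g y)) = 0" if y: "y \<in> F" for y
    proof -
      have "\<psi> (emb (l y) - g y) = 0"
        using y F by (auto simp: character_diff character_emb \<psi> g' emb_mem l)
      then show ?thesis
        using character_rules(2)[OF \<psi>, of "b y" "emb (l y) - g y"] b y
        by (simp add: diff_mem emb_mem g')
    qed
    moreover have "\<psi> (\<Sum>y\<in>F. b y * (emb (l y) - g y)) = (\<Sum>y\<in>F. \<psi> (b y * (emb (l y) - g y)))"
      using b by (intro character_sum \<psi> mem_rules g') auto
    ultimately have "\<psi> 1 = 0" using eq by simp
    with character_1[OF \<psi>] show False by simp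
  qed
  then have "1 \<notin> {(\<Sum>y\<in>F. b y * (emb (l y) - g y)) | b. \<forall>y\<in>F. b y \<in> B}"
    if "finite F" "F \<subseteq> Y" for F
    using that by blast
  moreover have "l \<in> extensional Y" by (simp add: l)
  ultimately show "l \<in> vector_spectrum B Y g"
    by (simp only: vector_spectrum_def mem_Collect_eq emb_def) simp
qed

end

section \<open>The algebra of values and the scalar part\<close>

lemma unital_complex_algebra_UNIV:
  "unital_complex_algebra (UNIV :: 'a::comm_complex_banach_algebra set)"
  by (unfold_locales; (rule scaleC_add_left scaleC_scaleC scaleC_one scaleC_mult_left)?)
    (simp_all add: complex_subalgebra_def)

lemma banach_algebra_carrier_UNIV:
  "banach_algebra_carrier (UNIV :: 'a::comm_complex_banach_algebra set) norm"
proof -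
  interpret unital_complex_algebra "UNIV :: 'a set"
    by (rule unital_complex_algebra_UNIV)
  show ?thesis
  proof
    show "complete_norm_on (UNIV :: 'a set) norm"
      unfolding complete_norm_on_def
    proof (intro allI impI)
      fix u :: "nat \<Rightarrow> 'a"
      assume "(\<forall>n. u n \<in> UNIV) \<and> (\<forall>e>0. \<exists>M. \<forall>m\<ge>M. \<forall>n\<ge>M. norm (u m - u n) < e)"
      then have "Cauchy u" by (auto simp: Cauchy_iff)
      then obtain b where "u \<longlonglongrightarrow> b"
        using Cauchy_convergent convergent_def by blast
      then show "\<exists>b\<in>UNIV. (\<lambda>n. norm (u n - b)) \<longlonglongrightarrow> 0"
        using LIM_zero tendsto_norm_zero by (metis UNIV_I)
    qed
  qed (auto simp: norm_triangle_ineq norm_scaleC norm_mult_ineq)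
qed

text \<open>
  Every maximal ideal is the kernel of a character, so an element that all characters map to
  zero lies in the Jacobson radical.
\<close>

lemma semisimple_characters_separate:
  fixes a b :: "'a::comm_complex_banach_algebra"
  assumes "semisimple TYPE('a)" and eq: "\<And>\<phi>. \<phi> \<in> characters UNIV \<Longrightarrow> \<phi> a = \<phi> b"
  shows "a = b"
proof -
  interpret banach_algebra_carrier "UNIV :: 'a set" norm
    by (rule banach_algebra_carrier_UNIV)
  have "a - b \<in> M" if M: "maximal_ideal M" for M :: "'a set"
  proof -
    have "ring_ideal M" "M \<noteq> UNIV" using M by (auto simp: maximal_ideal_def)
    then have "ideal_on M"
      by (simp add: ring_ideal_def ideal_on_def)
    moreover have "1 \<notin> M"
      using \<open>ring_ideal M\<close> \<open>M \<noteq> UNIV\<close> by (metis UNIV_eq_I mult.right_neutral ring_ideal_def)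
    ultimately obtain \<phi> where \<phi>: "\<phi> \<in> characters UNIV" "\<forall>a\<in>M. \<phi> a = 0"
      using proper_ideal_in_kernel_of_character by blast
    define K where "K = {a. \<phi> a = 0}"
    have "ring_ideal K"
      using \<phi>(1) by (auto simp: ring_ideal_def K_def character_rules character_0)
    moreover have "M \<subseteq> K" using \<phi>(2) by (auto simp: K_def)
    moreover have "K \<noteq> UNIV" using character_1[OF \<phi>(1)] by (auto simp: K_def set_eq_iff intro!: exI[of _ 1])
    ultimately have "K = M" using M by (auto simp: maximal_ideal_def)
    moreover have "a - b \<in> K"
      using eq[OF \<phi>(1)] by (simp add: K_def character_diff[OF \<phi>(1)])
    ultimately show ?thesis by simp
  qed
  then have "a - b \<in> \<Inter>{M. maximal_ideal M}" by blast
  with assms(1) show ?thesis by (simp add: semisimple_def)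
qed

lemma continuous_on_character:
  assumes "\<phi> \<in> characters (UNIV :: 'a::comm_complex_banach_algebra set)"
  shows "continuous_on UNIV \<phi>"
proof -
  interpret banach_algebra_carrier "UNIV :: 'a set" norm
    by (rule banach_algebra_carrier_UNIV)
  have "dist (\<phi> a) (\<phi> b) \<le> dist a b" for a b
    using character_bounded[OF assms, of "a - b"] character_diff[OF assms, of a b]
    by (simp add: dist_norm)
  then show ?thesis
    unfolding continuous_on_iff by (meson le_less_trans)
qed

text \<open>
  The line spanned by \<open>1\<close> is closed, because \<open>c \<mapsto> c 1\<close> multiplies distances by \<open>norm 1\<close> and the
  complex numbers are complete.
\<close>

lemma limit_of_scalars:
  fixes a :: "'a::comm_complex_banach_algebra"
  assumes "(\<lambda>n. u n *\<^sub>C (1::'a)) \<longlonglongrightarrow> a"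
  shows "\<exists>c. a = c *\<^sub>C 1"
proof -
  interpret unital_complex_algebra "UNIV :: 'a set"
    by (rule unital_complex_algebra_UNIV)
  have diff: "norm (c *\<^sub>C (1::'a) - d *\<^sub>C 1) = cmod (c - d) * norm (1::'a)" for c d
    using emb_diff[of c d] by (simp add: emb_def flip: norm_scaleC)
  have "Cauchy u"
    unfolding Cauchy_iff
  proof (intro allI impI)
    fix e :: real assume "e > 0"
    then have "e * norm (1::'a) > 0" by simp
    then obtain M where "\<forall>m\<ge>M. \<forall>n\<ge>M. norm (u m *\<^sub>C (1::'a) - u n *\<^sub>C 1) < e * norm (1::'a)"
      using LIMSEQ_imp_Cauchy[OF assms] unfolding Cauchy_iff by blast
    then show "\<exists>M. \<forall>m\<ge>M. \<forall>n\<ge>M. norm (u m - u n) < e"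
      by (auto simp: diff)
  qed
  then obtain c where c: "u \<longlonglongrightarrow> c"
    using Cauchy_convergent convergent_def by blast
  have "(\<lambda>n. cmod (u n - c) * norm (1::'a)) \<longlonglongrightarrow> 0 * norm (1::'a)"
    using c by (intro tendsto_intros tendsto_norm_zero LIM_zero)
  then have "(\<lambda>n. u n *\<^sub>C (1::'a)) \<longlonglongrightarrow> c *\<^sub>C 1"
    unfolding diff[symmetric] mult_zero_left
    by (rule LIM_zero_cancel[OF tendsto_norm_zero_cancel])
  with assms have "a = c *\<^sub>C 1" by (rule LIMSEQ_unique)
  then show ?thesis by blast
qed

text \<open>
  Only completeness needs an argument. A Cauchy sequence of scalar functions converges in \<open>\<A>\<close>.
  The norm of \<open>\<A>\<close> dominates the uniform norm, so the convergence is also pointwise, and the limit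
  has values in the closed line spanned by \<open>1\<close>.
\<close>

lemma scalar_part_banach:
  fixes \<A> :: "('x::t2_space \<Rightarrow> 'a::comm_complex_banach_algebra) set"
  assumes "compact (UNIV :: 'x set)" and \<A>: "banach_function_algebra \<A> N"
  shows "banach_algebra_carrier (scalar_part \<A>) (\<lambda>h. N (\<lambda>x. h x *\<^sub>C 1))"
proof -
  interpret E: unital_complex_algebra "UNIV :: 'a set"
    by (rule unital_complex_algebra_UNIV)
  define \<iota> :: "('x \<Rightarrow> complex) \<Rightarrow> 'x \<Rightarrow> 'a" where "\<iota> h = (\<lambda>x. E.emb (h x))" for h
  have \<iota>_eq: "(\<lambda>x. h x *\<^sub>C 1) = \<iota> h" for h by (simp add: \<iota>_def E.emb_def)
  have \<iota>: "\<iota> (h + k) = \<iota> h + \<iota> k" "\<iota> (h * k) = \<iota> h * \<iota> k" "\<iota> (c *\<^sub>C h) = c *\<^sub>C \<iota> h"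
    "\<iota> (h - k) = \<iota> h - \<iota> k" "\<iota> 0 = 0" for h k c
    by (simp_all add: \<iota>_def fun_eq_iff scaleC_fun_def scaleC_complex_def E.emb_add E.emb_mult
        E.emb_diff E.scale_eq_emb)
  have mem: "h \<in> scalar_part \<A> \<longleftrightarrow> continuous_on UNIV h \<and> \<iota> h \<in> \<A>" for h
    by (simp add: scalar_part_def \<iota>_eq)
  have norm_emb: "norm (E.emb c) = cmod c * norm (1::'a)" for c
    by (simp add: E.emb_def norm_scaleC)
  have fa: "function_algebra \<A>" and nm: "algebra_norm_on \<A> N" and cm: "complete_norm_on \<A> N"
    and sup: "\<And>f. f \<in> \<A> \<Longrightarrow> (SUP x. norm (f x)) \<le> N f"
    using \<A> by (auto simp: banach_function_algebra_def)
  have cont: "continuous_on UNIV f" if "f \<in> \<A>" for f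
    using fa that by (simp add: function_algebra_def)
  have sub: "complex_subalgebra \<A>" and const: "\<And>a. (\<lambda>x. a) \<in> \<A>"
    using fa by (auto simp: function_algebra_def)
  have scale_laws: "(c + d) *\<^sub>C h = c *\<^sub>C h + d *\<^sub>C h" "c *\<^sub>C d *\<^sub>C h = (c * d) *\<^sub>C h"
    "1 *\<^sub>C h = h" "(c *\<^sub>C h) * k = c *\<^sub>C (h * k)" for c d and h k :: "'x \<Rightarrow> complex"
    by (simp_all add: fun_eq_iff scaleC_fun_def scaleC_complex_def algebra_simps)
  have le_N: "norm (f x) \<le> N f" if f: "f \<in> \<A>" for f x
  proof -
    have "compact (range f)"
      using cont[OF f] assms(1) by (rule compact_continuous_image)
    then obtain C where "norm (f y) \<le> C" for y
      using compact_imp_bounded[of "range f"] by (auto simp: bounded_iff)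
    then have "bdd_above (range (\<lambda>x. norm (f x)))" by (rule bdd_aboveI2)
    then have "norm (f x) \<le> (SUP x. norm (f x))" by (intro cSUP_upper) auto
    with sup[OF f] show ?thesis by simp
  qed
  have add_mult: "f + g \<in> \<A>" "f * g \<in> \<A>" if "f \<in> \<A>" "g \<in> \<A>" for f g
    using sub that by (auto simp: complex_subalgebra_def)
  have zero_scale: "0 \<in> \<A>" "f \<in> \<A> \<Longrightarrow> c *\<^sub>C f \<in> \<A>" for f c
    using sub by (auto simp: complex_subalgebra_def)
  have cont_add_mult: "continuous_on UNIV (h + k)" "continuous_on UNIV (h * k)"
    if "continuous_on UNIV h" "continuous_on UNIV k" for h k :: "'x \<Rightarrow> complex"
    unfolding plus_fun_def times_fun_def
    using that by (auto intro: continuous_on_add continuous_on_mult)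
  have cont_zero_scale: "continuous_on UNIV (0 :: 'x \<Rightarrow> complex)"
    "continuous_on UNIV h \<Longrightarrow> continuous_on UNIV (c *\<^sub>C h)" for h :: "'x \<Rightarrow> complex" and c
    unfolding zero_fun_def scaleC_fun_def scaleC_complex_def
    by (auto intro: continuous_on_mult continuous_on_const)
  have "complex_subalgebra (scalar_part \<A>)"
    unfolding complex_subalgebra_def
    by (intro conjI ballI allI)
      (simp_all only: mem \<iota> cont_add_mult cont_zero_scale add_mult zero_scale simp_thms)
  moreover have "1 \<in> scalar_part \<A>"
    using const[of 1] by (simp add: mem \<iota>_def one_fun_def)
  moreover have "complete_norm_on (scalar_part \<A>) (\<lambda>h. N (\<iota> h))"
    unfolding complete_norm_on_def
  proof (intro allI impI)
    fix u :: "nat \<Rightarrow> 'x \<Rightarrow> complex"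
    assume u: "(\<forall>n. u n \<in> scalar_part \<A>) \<and>
      (\<forall>e>0. \<exists>M. \<forall>m\<ge>M. \<forall>n\<ge>M. N (\<iota> (u m - u n)) < e)"
    then have uA: "\<And>n. \<iota> (u n) \<in> \<A>" by (simp add: mem)
    with u obtain f where f: "f \<in> \<A>" and lim: "(\<lambda>n. N (\<iota> (u n) - f)) \<longlonglongrightarrow> 0"
      using cm[unfolded complete_norm_on_def, rule_format, of "\<lambda>n. \<iota> (u n)"] by (auto simp: \<iota>)
    have diff: "\<iota> (u n) - f \<in> \<A>" for n
    proof -
      have "(-1) *\<^sub>C f \<in> \<A>" using sub f by (simp add: complex_subalgebra_def)
      then have "\<iota> (u n) + (-1) *\<^sub>C f \<in> \<A>" using sub uA by (simp add: complex_subalgebra_def)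
      moreover have "\<iota> (u n) + (-1) *\<^sub>C f = \<iota> (u n) - f"
        by (simp add: fun_eq_iff scaleC_fun_def E.scale_eq_emb E.emb_minus)
      ultimately show ?thesis by simp
    qed
    have scalar_lim: "(\<lambda>n. u n x *\<^sub>C (1::'a)) \<longlonglongrightarrow> f x" for x
    proof -
      have "norm (u n x *\<^sub>C 1 - f x) \<le> N (\<iota> (u n) - f)" for n
        using le_N[OF diff, of n x] by (simp add: \<iota>_def E.emb_def)
      then have "(\<lambda>n. u n x *\<^sub>C 1 - f x) \<longlonglongrightarrow> 0"
        by (intro Lim_null_comparison[OF _ lim]) auto
      then show ?thesis by (rule LIM_zero_cancel)
    qed
    have "\<exists>c. f x = E.emb c" for x
      unfolding E.emb_def by (rule limit_of_scalars[OF scalar_lim])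
    then obtain h where "\<And>x. f x = E.emb (h x)" by metis
    then have h: "f = \<iota> h" by (auto simp: \<iota>_def)
    have "continuous_on UNIV h"
      unfolding continuous_on_def
    proof
      fix x :: 'x
      have "(f \<longlongrightarrow> f x) (at x)" using cont[OF f] by (simp add: continuous_on_def)
      then have "((\<lambda>y. norm (f y - f x) / norm (1::'a)) \<longlongrightarrow> 0 / norm (1::'a)) (at x)"
        by (intro tendsto_intros tendsto_norm_zero LIM_zero) auto
      then have "((\<lambda>y. cmod (h y - h x)) \<longlongrightarrow> 0) (at x)"
        by (simp add: h \<iota>_def norm_emb flip: E.emb_diff)
      then show "(h \<longlongrightarrow> h x) (at x within UNIV)"
        by (rule LIM_zero_cancel[OF tendsto_norm_zero_cancel])
    qed
    with f h lim show "\<exists>b\<in>scalar_part \<A>. (\<lambda>n. N (\<iota> (u n - b))) \<longlonglongrightarrow> 0"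
      by (intro bexI[of _ h]) (simp_all add: mem \<iota>)
  qed
  moreover have N_laws: "0 \<le> N (\<iota> h)" "N (\<iota> (c *\<^sub>C h)) = cmod c * N (\<iota> h)"
      "k \<in> scalar_part \<A> \<Longrightarrow> N (\<iota> (h + k)) \<le> N (\<iota> h) + N (\<iota> k)"
      "k \<in> scalar_part \<A> \<Longrightarrow> N (\<iota> (h * k)) \<le> N (\<iota> h) * N (\<iota> k)"
    if "h \<in> scalar_part \<A>" for h k c
    using nm that by (simp_all only: algebra_norm_on_def mem \<iota>)
  moreover have "h = 0" if "h \<in> scalar_part \<A>" "N (\<iota> h) = 0" for h
  proof -
    have "\<iota> h = 0" using that nm by (simp add: algebra_norm_on_def mem)
    then have "E.emb (h x) = 0" for x by (simp add: \<iota>_def fun_eq_iff)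
    then have "cmod (h x) * norm (1::'a) = 0" for x using norm_emb[of "h x"] by simp
    then show ?thesis by (simp add: fun_eq_iff)
  qed
  ultimately show ?thesis
    unfolding \<iota>_eq using N_laws
    by (intro banach_algebra_carrier.intro algebra_seminorm.intro unital_complex_algebra.intro
        algebra_seminorm_axioms.intro banach_algebra_carrier_axioms.intro)
      (simp_all only: scale_laws)
qed

section \<open>The spectrum of a vector-valued function\<close>

theorem corollary4p4:
  fixes \<A> :: "('x::t2_space \<Rightarrow> 'a::comm_complex_banach_algebra) set"
    and N :: "('x \<Rightarrow> 'a) \<Rightarrow> real"
  assumes "compact (UNIV :: 'x set)"
    and "semisimple TYPE('a)"
    and "banach_function_algebra \<A> N"
    and "admissible \<A>"
    and "natural (scalar_part \<A>)"
  shows "\<forall>f\<in>\<A>. algebra_spectrum \<A> f = range f \<and> compact (algebra_spectrum \<A> f)"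
proof (intro ballI conjI)
  fix f assume f: "f \<in> \<A>"
  interpret banach_algebra_carrier "scalar_part \<A>" "\<lambda>h. N (\<lambda>x. h x *\<^sub>C 1)"
    by (rule scalar_part_banach[OF assms(1,3)])
  have cont: "continuous_on UNIV f"
    using assms(3) f by (simp add: banach_function_algebra_def function_algebra_def)
  have mem: "\<phi> \<circ> f \<in> scalar_part \<A>" if \<phi>: "\<phi> \<in> characters UNIV" for \<phi>
  proof -
    have "continuous_on UNIV (\<phi> \<circ> f)"
      using cont continuous_on_character[OF \<phi>]
      by (intro continuous_on_compose) (auto intro: continuous_on_subset)
    then show ?thesis
      using assms(4) \<phi> f by (simp add: scalar_part_def admissible_def)
  qed
  \<comment> \<open>By naturality the characters of the scalar part are the evaluations.\<close>
  have "a \<in> algebra_spectrum \<A> f \<longleftrightarrow> (\<exists>x. \<forall>\<phi>\<in>characters UNIV. \<phi> a = \<phi> (f x))" for a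
  proof -
    have "a \<in> algebra_spectrum \<A> f \<longleftrightarrow>
        (\<exists>x. gelfand a = (\<lambda>\<phi>\<in>characters UNIV. (\<lambda>h\<in>scalar_part \<A>. h x) (\<phi> \<circ> f)))"
      using assms(5) mem unfolding algebra_spectrum_def natural_def
      by (subst vector_spectrum_eq_characters) (simp_all add: image_iff)
    also have "\<dots> \<longleftrightarrow> (\<exists>x. \<forall>\<phi>\<in>characters UNIV. \<phi> a = \<phi> (f x))"
      by (intro ex_cong1) (auto simp: gelfand_def fun_eq_iff mem restrict_def)
    finally show ?thesis .
  qed
  then show range: "algebra_spectrum \<A> f = range f"
    using semisimple_characters_separate[OF assms(2)] by (auto, metis rangeI)
  show "compact (algebra_spectrum \<A> f)"
    unfolding range using cont assms(1) by (rule compact_continuous_image)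
qed

end
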